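(* Let $n$ be a positive integer. Consider the equation $$x^2+y^4+z^4-2xy^2-2xz^2-2y^2z^2=n .$$ 1) If $n$ is not a perfect square, then the equation has no integer solutions with $xyz=0$; that is, with at least one of $x$, $y$, or $z$ being zero. 2) Suppose that $n=k^2$, where $k$ is a positive integer. (a) If $k$ is not a perfect square, then the equation has no integer solutions with $x=0$ and with one of $y,z$ also being zero. (b) If $k=m^2$, $m$ a positive integer, then the integer solutions with $x=0$ and with one of $y,z$ also zero are $(0,\pm m,0)$, $(0,0,\pm m)$; four such solutions in total. (c) If $k\equiv 2\pmod 4$, there are no integer solutions with $x=0$. (d) The integer solutions with $x\ne 0$ and $yz=0$ can be described as follows: $x=t^2\pm k$, $y=t$, $z=0$ is one family of such solutions, and $x=t^2\pm k$, $y=0$, $z=t$ is the other, where $t$ can be any integer, with one exception: if $k=m^2$ for a positive integer $m$ and the minus sign holds, then $t\ne\pm m$, i.e. $|t|\ne m$ (so that $x\ne 0$). 3) The integer solutions with $yz\ne 0$ can be described as follows. If $n\equiv 2$ or $3\pmod 4$, then there are no such integer solutions. If $n\equiv 0$ or $1\pmod 4$, then all such integer solutions can be described in the following way. For every pair of divisors $d_1$ and $d_2$ of $n$ such that $d_1d_2=n$, $1\le d_2<d_1$, $d_1\equiv d_2\pmod 4$ (when $n\equiv 0\pmod 4$, $d_1=\frac{n}{2}$, $d_2=2$ is such a combination; when $n\equiv 1\pmod 4$, $d_1=n$, $d_2=1$ is such a combination), define $e=\frac{d_1-d_2}{4}$ and $f=\frac{d_1+d_2}{2}$. Then all the integer solutions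 determined by this pair of divisors are given by $$x=\pm\left[\rho^2+\left(\frac{e}{\rho}\right)^2\pm f\right],\qquad y=\pm\rho,\qquad z=\pm\frac{e}{\rho},$$ where $\rho$ is a positive integer divisor of the positive integer $e$, and with all sign combinations being possible.
   Formalization: In part 3 the outer ± in x is dropped (for n=5 it would give the non-solution (-5,1,1)); the example pair (n/2, 2) is claimed only for n≡4 (mod 8), n≠4, and the pair (n, 1) only for n≡1 (mod 4), n≠1. *)

theory Defs
  imports "HOL-Computational_Algebra.Nth_Powers" "HOL-Number_Theory.Cong"
begin

definition solutions :: "int \<Rightarrow> (int \<times> int \<times> int) set" where
  "solutions n = {(x, y, z).
     x^2 + y^4 + z^4 - 2 * x * y^2 - 2 * x * z^2 - 2 * y^2 * z^2 = n}"

(* The restriction in the second conjunct of each family is exactly the exception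
   "if k = m^2 and the minus sign holds, then |t| is not m". *)

definition family_z0 :: "int \<Rightarrow> (int \<times> int \<times> int) set" where
  "family_z0 k = {(t^2 + s * k, t, 0) | s t.
     s \<in> {1, -1} \<and> \<not> (s = -1 \<and> (\<exists>m>0. k = m^2 \<and> \<bar>t\<bar> = m))}"

definition family_y0 :: "int \<Rightarrow> (int \<times> int \<times> int) set" where
  "family_y0 k = {(t^2 + s * k, 0, t) | s t.
     s \<in> {1, -1} \<and> \<not> (s = -1 \<and> (\<exists>m>0. k = m^2 \<and> \<bar>t\<bar> = m))}"

definition admissible_pair :: "int \<Rightarrow> int \<Rightarrow> int \<Rightarrow> bool" where
  "admissible_pair n d1 d2 \<longleftrightarrow>
     d1 dvd n \<and> d2 dvd n \<and> d1 * d2 = n \<and> 1 \<le> d2 \<and> d2 < d1 \<and> [d1 = d2] (mod 4)"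

(* For an admissible pair both divisions in e and f are exact, and so is e div r
   for r dvd e.  The three signs vary independently.  There is no further sign in
   front of the first component: negating a nonzero first component of such a
   triple never gives a solution (e.g. for n = 5, (5, 1, 1) solves the equation
   and (-5, 1, 1) does not). *)

definition pair_solutions :: "int \<Rightarrow> int \<Rightarrow> (int \<times> int \<times> int) set" where
  "pair_solutions d1 d2 =
     (let e = (d1 - d2) div 4; f = (d1 + d2) div 2
      in {(r^2 + (e div r)^2 + s1 * f, s2 * r, s3 * (e div r)) | r s1 s2 s3.
            r > 0 \<and> r dvd e \<and> s1 \<in> {1, -1} \<and> s2 \<in> {1, -1} \<and> s3 \<in> {1, -1}})"

end

theory Submission
  imports Defs
begin

text \<open>
  The quartic form is a difference of two squares,
  \<open>(x - y\<^sup>2 - z\<^sup>2)\<^sup>2 - (2 y z)\<^sup>2\<close>, which is the content of \<open>solutions_iff\<close>. With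
  \<open>w = x - y\<^sup>2 - z\<^sup>2\<close> the equation thus reads \<open>w\<^sup>2 - 4 (y z)\<^sup>2 = n\<close>, and \<open>x\<close> can be recovered
  from \<open>w\<close>, \<open>y\<close>, \<open>z\<close> without restriction.

  If \<open>y z = 0\<close>, then \<open>n = w\<^sup>2\<close>, so \<open>n = k\<^sup>2\<close> and \<open>w = \<plusminus>k\<close>; this gives the two one-parameter
  families. If \<open>x = 0\<close>, the form is also the square \<open>(y\<^sup>2 - z\<^sup>2)\<^sup>2\<close>, so that again \<open>n = k\<^sup>2\<close> and
  \<open>k\<close> is up to sign a difference of two squares, hence not \<open>2\<close> modulo \<open>4\<close>.

  If \<open>y z \<noteq> 0\<close>, then \<open>n = (\<bar>w\<bar> + 2 \<bar>y z\<bar>) (\<bar>w\<bar> - 2 \<bar>y z\<bar>)\<close>. The two factors are the divisors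
  \<open>d\<^sub>1\<close> and \<open>d\<^sub>2\<close>; they differ by \<open>4 \<bar>y z\<bar>\<close>, so \<open>e = \<bar>y z\<bar>\<close> and \<open>f = \<bar>w\<bar>\<close>, and all that is
  left to choose is the splitting of \<open>e\<close> into \<open>\<rho> = \<bar>y\<bar>\<close> and \<open>e / \<rho> = \<bar>z\<bar>\<close>, and the signs
  (\<open>solutions_nonzero_yz\<close>). A square is \<open>0\<close> or \<open>1\<close> modulo \<open>4\<close>, and so is \<open>n = w\<^sup>2 - 4 (y z)\<^sup>2\<close>.
\<close>

section \<open>The form as a difference of two squares\<close>

lemma solutions_iff:
  "(x, y, z) \<in> solutions n \<longleftrightarrow> (x - y^2 - z^2)^2 - 4 * (y * z)^2 = n"
  by (simp add: solutions_def power2_eq_square power4_eq_xxxx algebra_simps)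

lemma solutions_iff_x0: "(0, y, z) \<in> solutions n \<longleftrightarrow> (y^2 - z^2)^2 = n"
  by (simp add: solutions_def power2_eq_square power4_eq_xxxx algebra_simps)

lemma solutions_swap: "(x, y, z) \<in> solutions n \<longleftrightarrow> (x, z, y) \<in> solutions n"
  by (simp add: solutions_def algebra_simps)

lemma int_square_mod_4: "(a::int)^2 mod 4 = (if even a then 0 else 1)"
proof (cases "even a")
  case True
  then obtain b where "a = 2 * b" by (rule evenE)
  then show ?thesis by (simp add: power_mult_distrib)
next
  case False
  then obtain b where "a = 2 * b + 1" by (rule oddE)
  then have "a^2 = 1 + 4 * (b^2 + b)" by (simp add: power2_eq_square algebra_simps)
  then have "a^2 mod 4 = 1 mod 4" by (metis mod_mult_self2)
  then show ?thesis using False by simp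
qed

section \<open>Solutions with a zero component\<close>

lemma solution_product_zero_imp_square:
  assumes "(x, y, z) \<in> solutions n" "x * y * z = 0"
  shows "is_square n"
proof -
  consider "x = 0" | "y * z = 0" using assms(2) by auto
  then have "\<exists>b. n = b^2"
  proof cases
    case 1
    then show ?thesis using assms(1) by (auto simp: solutions_iff_x0)
  next
    case 2
    then show ?thesis using assms(1) by (auto simp: solutions_iff)
  qed
  then show ?thesis by (auto simp: is_nth_power_def)
qed

lemma solutions_two_zeros:
  assumes "k > 0"
  shows "(0, t, 0) \<in> solutions (k^2) \<longleftrightarrow> t^2 = k"
    and "(0, 0, t) \<in> solutions (k^2) \<longleftrightarrow> t^2 = k"
proof -
  show *: "(0, t, 0) \<in> solutions (k^2) \<longleftrightarrow> t^2 = k"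
    using assms power2_eq_iff_nonneg[of "t^2" k] by (simp add: solutions_iff_x0)
  then show "(0, 0, t) \<in> solutions (k^2) \<longleftrightarrow> t^2 = k"
    by (simp add: solutions_swap[of 0 0 t])
qed

lemma solutions_two_zeros_fourth_power:
  assumes "(m::int) > 0"
  shows "{(x, y, z). (x, y, z) \<in> solutions ((m^2)^2) \<and> x = 0 \<and> (y = 0 \<or> z = 0)}
           = {(0, m, 0), (0, -m, 0), (0, 0, m), (0, 0, -m)}"
  using solutions_two_zeros[of "m^2"] assms by (auto simp: power2_eq_iff)

lemma no_solution_x0_if_2_mod_4:
  assumes "[k = 2] (mod 4)"
  shows "(0, y, z) \<notin> solutions (k^2)"
proof
  assume "(0, y, z) \<in> solutions (k^2)"
  then have "y^2 - z^2 = k \<or> y^2 - z^2 = - k"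
    by (simp add: solutions_iff_x0 power2_eq_iff)
  then have "y^2 = z^2 + k \<or> z^2 = y^2 + k" by auto
  moreover have "a^2 \<noteq> b^2 + k" for a b
  proof
    assume "a^2 = b^2 + k"
    then have "a^2 mod 4 = (b^2 mod 4 + k mod 4) mod 4" by (simp add: mod_add_eq)
    then show False using assms
      by (simp add: int_square_mod_4 cong_def split: if_splits)
  qed
  ultimately show False by blast
qed

text \<open>The excluded parameters of the two families are exactly those with vanishing first
  component: for \<open>s = 1\<close> it is positive, and \<open>t\<^sup>2 - k = 0\<close> forces \<open>k\<close> to be the square of the
  positive integer \<open>\<bar>t\<bar>\<close>.\<close>

lemma family_exception_iff:
  assumes "(k::int) > 0" "s \<in> {1, -1}"
  shows "(s = -1 \<and> (\<exists>m>0. k = m^2 \<and> \<bar>t\<bar> = m)) \<longleftrightarrow> t^2 + s * k = 0"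
proof
  assume "t^2 + s * k = 0"
  moreover have "t^2 + k > 0" using assms(1) by (simp add: add_nonneg_pos)
  ultimately have s: "s = -1" "k = t^2" using assms(2) by auto
  then have "k = \<bar>t\<bar>^2" "\<bar>t\<bar> > 0" using assms(1) by auto
  then show "s = -1 \<and> (\<exists>m>0. k = m^2 \<and> \<bar>t\<bar> = m)" using s(1) by blast
qed auto

lemma mem_family_z0:
  assumes "k > 0"
  shows "(x, y, z) \<in> family_z0 k \<longleftrightarrow> (x, y, z) \<in> solutions (k^2) \<and> x \<noteq> 0 \<and> z = 0"
proof -
  have "(x, y, z) \<in> family_z0 k \<longleftrightarrow>
      (\<exists>s. s \<in> {1, -1} \<and> x = y^2 + s * k \<and> \<not> (s = -1 \<and> (\<exists>m>0. k = m^2 \<and> \<bar>y\<bar> = m))) \<and> z = 0"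
    unfolding family_z0_def by blast
  also have "\<dots> \<longleftrightarrow> (\<exists>s. s \<in> {1, -1} \<and> x = y^2 + s * k \<and> x \<noteq> 0) \<and> z = 0"
    using family_exception_iff[OF assms, of _ y] by blast
  also have "\<dots> \<longleftrightarrow> (x = y^2 + 1 * k \<or> x = y^2 + -1 * k) \<and> x \<noteq> 0 \<and> z = 0"
    by blast
  also have "\<dots> \<longleftrightarrow> (x, y, z) \<in> solutions (k^2) \<and> x \<noteq> 0 \<and> z = 0"
    by (auto simp: solutions_iff power2_eq_iff)
  finally show ?thesis .
qed

lemma mem_family_y0:
  assumes "k > 0"
  shows "(x, y, z) \<in> family_y0 k \<longleftrightarrow> (x, y, z) \<in> solutions (k^2) \<and> x \<noteq> 0 \<and> y = 0"
proof -
  have "(x, y, z) \<in> family_y0 k \<longleftrightarrow> (x, z, y) \<in> family_z0 k"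
    by (auto simp: family_y0_def family_z0_def)
  then show ?thesis using mem_family_z0[OF assms, of x z y] solutions_swap by blast
qed

lemma solutions_nonzero_x_zero_yz:
  assumes "k > 0"
  shows "{(x, y, z). (x, y, z) \<in> solutions (k^2) \<and> x \<noteq> 0 \<and> y * z = 0}
           = family_z0 k \<union> family_y0 k"
  by (auto simp: mem_family_z0[OF assms] mem_family_y0[OF assms])

section \<open>Solutions with nonzero \<open>y\<close> and \<open>z\<close>\<close>

lemma solutions_imp_0_or_1_mod_4:
  assumes "(x, y, z) \<in> solutions n"
  shows "n mod 4 \<in> {0, 1}"
proof -
  have "(x - y^2 - z^2)^2 = n + 4 * (y * z)^2" using assms by (simp add: solutions_iff)
  then have "(x - y^2 - z^2)^2 mod 4 = n mod 4" by simp
  then show ?thesis by (auto simp: int_square_mod_4 split: if_splits)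
qed

text \<open>Both divisions that define \<open>e\<close> and \<open>f\<close> are exact. Substituting \<open>d\<^sub>1 = f + 2 e\<close> and
  \<open>d\<^sub>2 = f - 2 e\<close> turns an admissible pair into a representation \<open>n = f\<^sup>2 - 4 e\<^sup>2\<close>.\<close>

lemma admissible_pairE:
  assumes "admissible_pair n d1 d2"
  obtains e f where "d1 = f + 2 * e" "d2 = f - 2 * e" "e > 0"
    "(d1 - d2) div 4 = e" "(d1 + d2) div 2 = f" "n = f^2 - 4 * e^2"
proof -
  have d: "d1 * d2 = n" "d2 < d1" "[d1 = d2] (mod 4)"
    using assms by (auto simp: admissible_pair_def)
  then obtain e where "d1 - d2 = 4 * e"
    by (auto simp: cong_iff_dvd_diff dvd_def)
  then have d1: "d1 = d2 + 4 * e" by simp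
  show thesis
  proof (rule that[of "d2 + 2 * e" e])
    show "(d1 + d2) div 2 = d2 + 2 * e" by (simp add: d1)
    show "n = (d2 + 2 * e)^2 - 4 * e^2"
      using d(1) by (simp add: d1 power2_eq_square algebra_simps)
  qed (use d d1 in auto)
qed

lemma pair_solutions_subset:
  assumes "admissible_pair n d1 d2" "(x, y, z) \<in> pair_solutions d1 d2"
  shows "(x, y, z) \<in> solutions n \<and> y * z \<noteq> 0"
proof -
  obtain e f where ef: "e > 0" "(d1 - d2) div 4 = e" "(d1 + d2) div 2 = f" "n = f^2 - 4 * e^2"
    using assms(1) by (rule admissible_pairE)
  from assms(2) obtain r s1 s2 s3 where r: "r dvd e"
    and s: "s1 \<in> {1, -1}" "s2 \<in> {1, -1}" "s3 \<in> {1, -1}"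
    and xyz: "x = r^2 + (e div r)^2 + s1 * f" "y = s2 * r" "z = s3 * (e div r)"
    by (auto simp: pair_solutions_def ef Let_def)
  have e: "r * (e div r) = e" using r by simp
  have sq: "s1^2 = 1" "s2^2 = 1" "s3^2 = 1" using s by auto
  have yz: "y * z = s2 * s3 * e" using e by (simp add: xyz mult.left_commute mult.assoc)
  have "y^2 = r^2" "z^2 = (e div r)^2" by (simp_all add: xyz power_mult_distrib sq)
  then have "x - y^2 - z^2 = s1 * f" by (simp add: xyz(1))
  then have "(x, y, z) \<in> solutions n"
    by (simp add: solutions_iff yz ef(4) power_mult_distrib sq)
  moreover have "y * z \<noteq> 0" using s ef(1) by (auto simp: yz)
  ultimately show ?thesis ..
qed

text \<open>The inverse direction reads \<open>d\<^sub>1\<close> and \<open>d\<^sub>2\<close> off the factorisation of \<open>w\<^sup>2 - (2 y z)\<^sup>2\<close>.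
  Absolute values make \<open>d\<^sub>1\<close> positive, and then \<open>n > 0\<close> makes \<open>d\<^sub>2\<close> positive too.\<close>

lemma solution_in_pair_solutions:
  assumes "n > 0" "(x, y, z) \<in> solutions n" "y * z \<noteq> 0"
  obtains d1 d2 where "admissible_pair n d1 d2" "(x, y, z) \<in> pair_solutions d1 d2"
proof -
  define w where "w = x - y^2 - z^2"
  define e where "e = \<bar>y\<bar> * \<bar>z\<bar>"
  define d1 where "d1 = \<bar>w\<bar> + 2 * e"
  define d2 where "d2 = \<bar>w\<bar> - 2 * e"
  have e: "e > 0" using assms(3) by (simp add: e_def)
  have "e^2 = (y * z)^2" by (simp add: e_def power_mult_distrib)
  then have "n = \<bar>w\<bar>^2 - 4 * e^2" using assms(2) by (simp add: solutions_iff w_def)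
  then have n: "d1 * d2 = n" by (simp add: d1_def d2_def power2_eq_square algebra_simps)
  have "d1 > 0" using e by (simp add: d1_def)
  then have "d2 > 0" using n assms(1) zero_less_mult_pos by blast
  moreover have "[d1 = d2] (mod 4)" by (simp add: cong_iff_dvd_diff d1_def d2_def)
  ultimately have "admissible_pair n d1 d2"
    using n e by (auto simp: admissible_pair_def d1_def d2_def)
  moreover have "(x, y, z) \<in> pair_solutions d1 d2"
  proof -
    have div: "(d1 - d2) div 4 = e" "(d1 + d2) div 2 = \<bar>w\<bar>" "e div \<bar>y\<bar> = \<bar>z\<bar>"
      using assms(3) by (auto simp: d1_def d2_def e_def)
    \<comment> \<open>The standard \<open>sgn\<close> is \<open>0\<close> at \<open>0\<close>, but \<open>w = 0\<close> still needs a sign from \<open>{1, -1}\<close>.\<close>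
    define sg :: "int \<Rightarrow> int" where "sg a = (if a < 0 then -1 else 1)" for a
    have sg: "sg a \<in> {1, -1}" "sg a * \<bar>a\<bar> = a" for a by (auto simp: sg_def)
    show ?thesis
      unfolding pair_solutions_def Let_def div(1,2) mem_Collect_eq
    proof (intro exI conjI)
      show "(x, y, z) = (\<bar>y\<bar>^2 + (e div \<bar>y\<bar>)^2 + sg w * \<bar>w\<bar>, sg y * \<bar>y\<bar>, sg z * (e div \<bar>y\<bar>))"
        unfolding div(3) sg(2) by (simp add: w_def)
      show "\<bar>y\<bar> > 0" "\<bar>y\<bar> dvd e" using assms(3) by (auto simp: e_def)
    qed (rule sg(1))+
  qed
  ultimately show thesis by (rule that)
qed

lemma solutions_nonzero_yz:
  assumes "n > 0"
  shows "{(x, y, z). (x, y, z) \<in> solutions n \<and> y * z \<noteq> 0}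
           = (\<Union>(d1, d2) \<in> {(d1, d2). admissible_pair n d1 d2}. pair_solutions d1 d2)"
  (is "?L = ?R")
proof (intro equalityI subsetI)
  fix p assume "p \<in> ?L"
  then obtain x y z where p: "p = (x, y, z)" and xyz: "(x, y, z) \<in> solutions n" "y * z \<noteq> 0"
    by blast
  obtain d1 d2 where "admissible_pair n d1 d2" "(x, y, z) \<in> pair_solutions d1 d2"
    using solution_in_pair_solutions[OF assms xyz] by blast
  then show "p \<in> ?R" unfolding p by blast
next
  fix p assume "p \<in> ?R"
  then show "p \<in> ?L" using pair_solutions_subset by (cases p) blast
qed

lemma admissible_pair_half_2:
  assumes "n > 0" "[n = 4] (mod 8)" "n \<noteq> 4"
  shows "admissible_pair n (n div 2) 2"
proof -
  have "n mod 8 = 4" using assms(2) by (simp add: cong_def)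
  then have "n = 4 + 8 * (n div 8)" by presburger
  then obtain j where j: "n = 4 + 8 * j" by blast
  then have "j > 0" using assms by simp
  moreover have half: "n div 2 = 2 + 4 * j" using j by simp
  moreover have "n = n div 2 * 2" using j half by simp
  then have "n div 2 dvd n" "2 dvd n" "n div 2 * 2 = n"
    by (metis dvd_triv_left, metis dvd_triv_right, simp)
  ultimately show ?thesis by (simp add: admissible_pair_def cong_iff_dvd_diff)
qed

lemma admissible_pair_self_1:
  assumes "n > 0" "[n = 1] (mod 4)" "n \<noteq> 1"
  shows "admissible_pair n n 1"
  using assms by (simp add: admissible_pair_def)

section \<open>The classification of solutions\<close>

theorem theorem11:
  fixes n :: int
  assumes "n > 0"
  shows
    "(\<not> is_square n \<longrightarrow> \<not> (\<exists>x y z. (x, y, z) \<in> solutions n \<and> x * y * z = 0))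
     \<and> (\<forall>k>0. n = k^2 \<longrightarrow>
          (\<not> is_square k \<longrightarrow>
             \<not> (\<exists>x y z. (x, y, z) \<in> solutions n \<and> x = 0 \<and> (y = 0 \<or> z = 0)))
        \<and> (\<forall>m>0. k = m^2 \<longrightarrow>
             {(x, y, z). (x, y, z) \<in> solutions n \<and> x = 0 \<and> (y = 0 \<or> z = 0)}
               = {(0, m, 0), (0, -m, 0), (0, 0, m), (0, 0, -m)}
           \<and> card {(x, y, z). (x, y, z) \<in> solutions n \<and> x = 0 \<and> (y = 0 \<or> z = 0)} = 4)
        \<and> ([k = 2] (mod 4) \<longrightarrow>
             \<not> (\<exists>x y z. (x, y, z) \<in> solutions n \<and> x = 0))
        \<and> {(x, y, z). (x, y, z) \<in> solutions n \<and> x \<noteq> 0 \<and> y * z = 0}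
             = family_z0 k \<union> family_y0 k)
     \<and> ([n = 2] (mod 4) \<or> [n = 3] (mod 4) \<longrightarrow>
          \<not> (\<exists>x y z. (x, y, z) \<in> solutions n \<and> y * z \<noteq> 0))
     \<and> ([n = 0] (mod 4) \<or> [n = 1] (mod 4) \<longrightarrow>
          {(x, y, z). (x, y, z) \<in> solutions n \<and> y * z \<noteq> 0}
            = (\<Union>(d1, d2) \<in> {(d1, d2). admissible_pair n d1 d2}. pair_solutions d1 d2))
     \<and> ([n = 4] (mod 8) \<and> n \<noteq> 4 \<longrightarrow> admissible_pair n (n div 2) 2)
     \<and> ([n = 1] (mod 4) \<and> n \<noteq> 1 \<longrightarrow> admissible_pair n n 1)"
proof (intro conjI)
  show "\<not> is_square n \<longrightarrow> \<not> (\<exists>x y z. (x, y, z) \<in> solutions n \<and> x * y * z = 0)"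
    using solution_product_zero_imp_square by blast
next
  show "\<forall>k>0. n = k^2 \<longrightarrow>
          (\<not> is_square k \<longrightarrow>
             \<not> (\<exists>x y z. (x, y, z) \<in> solutions n \<and> x = 0 \<and> (y = 0 \<or> z = 0)))
        \<and> (\<forall>m>0. k = m^2 \<longrightarrow>
             {(x, y, z). (x, y, z) \<in> solutions n \<and> x = 0 \<and> (y = 0 \<or> z = 0)}
               = {(0, m, 0), (0, -m, 0), (0, 0, m), (0, 0, -m)}
           \<and> card {(x, y, z). (x, y, z) \<in> solutions n \<and> x = 0 \<and> (y = 0 \<or> z = 0)} = 4)
        \<and> ([k = 2] (mod 4) \<longrightarrow>
             \<not> (\<exists>x y z. (x, y, z) \<in> solutions n \<and> x = 0))
        \<and> {(x, y, z). (x, y, z) \<in> solutions n \<and> x \<noteq> 0 \<and> y * z = 0}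
             = family_z0 k \<union> family_y0 k"
  proof (intro allI impI conjI)
    fix k :: int assume k: "k > 0" and n: "n = k^2"
    show "\<not> (\<exists>x y z. (x, y, z) \<in> solutions n \<and> x = 0 \<and> (y = 0 \<or> z = 0))"
      if "\<not> is_square k"
      using that solutions_two_zeros[OF k] by (auto simp: n is_nth_power_def)
    show "\<not> (\<exists>x y z. (x, y, z) \<in> solutions n \<and> x = 0)" if "[k = 2] (mod 4)"
      using no_solution_x0_if_2_mod_4[OF that] by (auto simp: n)
    show "{(x, y, z). (x, y, z) \<in> solutions n \<and> x \<noteq> 0 \<and> y * z = 0}
            = family_z0 k \<union> family_y0 k"
      unfolding n by (rule solutions_nonzero_x_zero_yz[OF k])
    fix m :: int assume m: "m > 0" "k = m^2"
    show *: "{(x, y, z). (x, y, z) \<in> solutions n \<and> x = 0 \<and> (y = 0 \<or> z = 0)}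
               = {(0, m, 0), (0, -m, 0), (0, 0, m), (0, 0, -m)}"
      unfolding n m(2) by (rule solutions_two_zeros_fourth_power[OF m(1)])
    show "card {(x, y, z). (x, y, z) \<in> solutions n \<and> x = 0 \<and> (y = 0 \<or> z = 0)} = 4"
      unfolding * using m(1) by simp
  qed
next
  show "[n = 2] (mod 4) \<or> [n = 3] (mod 4) \<longrightarrow>
          \<not> (\<exists>x y z. (x, y, z) \<in> solutions n \<and> y * z \<noteq> 0)"
    using solutions_imp_0_or_1_mod_4[of _ _ _ n] by (fastforce simp: cong_def)
qed (use solutions_nonzero_yz admissible_pair_half_2 admissible_pair_self_1 assms in blast)+

end
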